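(* Let $n=4$. There exists an absolute constant $\delta_{\rm Gap}>0$ such that for every integer $m\ge 0$ and every fixed family of $m$ valid linear cuts $\{\ell_1,\dots,\ell_m\}$ in dimension $4$, there exists a submodular BCQP instance $(Q,c)$ for which the SDP relaxation with cuts $\ell_1,\dots,\ell_m$ has a strictly positive relaxation gap of at least $\delta_{\rm Gap}/(m+1)^2$.
   Context: $\mathbb{S}^n$ is the space of real symmetric $n\times n$ matrices and $Q\bullet X=\sum_{i,j}Q_{ij}X_{ij}$. A submodular box-constrained quadratic program (BCQP) instance is a pair $(Q,c)\in\mathbb{S}^n\times\mathbb{R}^n$ with $Q_{ij}\le 0$ for all $i\ne j$; the problem is $\min\{x^\top Qx+c^\top x: x\in[0,1]^n\}$. Let $$\mathcal{S}_n=\Big\{(x,X)\in\mathbb{R}^n\times\mathbb{S}^n:\begin{pmatrix} 1 & x^\top \\ x & X \end{pmatrix}\succeq0\Big\}.$$ A valid linear cut is an inequality $\ell(x,X)\ge 0$ with $\ell(x,X)=c_0+\sum_i b_ix_i+\sum_i d_iX_{ii}+\sum_{1\le i<j\le n}h_{ij}X_{ij}$ such that $\ell(x,xx^\top)\ge 0$ for all $x\in[0,1]^n$. The SDP relaxation with cuts $\ell_1,\dots,\ell_m$ is $$\min\{Q\bullet X+c^\top x:\ (x,X)\in\mathcal{S}_n,\ \ell_i(x,X)\ge 0,\ i=1,\dots,m\},$$ its value being understood as an infimum in $\mathbb{R}\cup\{-\infty\}$. The relaxation gap is the BCQP optimal value minus the SDP optimal value. *)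

theory Defs
  imports "HOL-Analysis.Analysis"
begin

definition symmetric_matrix :: "real^'n^'n \<Rightarrow> bool" where
  "symmetric_matrix A \<longleftrightarrow> transpose A = A"

definition psd :: "real^'n^'n \<Rightarrow> bool" where
  "psd A \<longleftrightarrow> symmetric_matrix A \<and> (\<forall>v. 0 \<le> v \<bullet> (A *v v))"

definition unit_box :: "(real^'n) set" where
  "unit_box = {x. \<forall>i. 0 \<le> x $ i \<and> x $ i \<le> 1}"

definition submodular_instance :: "real^'n^'n \<Rightarrow> real^'n \<Rightarrow> bool" where
  "submodular_instance Q c \<longleftrightarrow> symmetric_matrix Q \<and> (\<forall>i j. i \<noteq> j \<longrightarrow> Q $ i $ j \<le> 0)"

definition bcqp_value :: "real^'n^'n \<Rightarrow> real^'n \<Rightarrow> ereal" where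
  "bcqp_value Q c = (INF x \<in> unit_box. ereal (x \<bullet> (Q *v x) + c \<bullet> x))"

text \<open>The bordered matrix with first row \<open>(1, x)\<close> and remaining rows \<open>(x, X)\<close>; the extra
  index is \<open>None\<close>.\<close>

definition bordered_matrix :: "real^'n \<Rightarrow> real^'n^'n \<Rightarrow> real^('n option)^('n option)" where
  "bordered_matrix x X = (\<chi> i j.
     case i of
       None \<Rightarrow> (case j of None \<Rightarrow> 1 | Some l \<Rightarrow> x $ l)
     | Some k \<Rightarrow> (case j of None \<Rightarrow> x $ k | Some l \<Rightarrow> X $ k $ l))"

definition lifted_set :: "((real^'n) \<times> (real^'n^'n)) set" where
  "lifted_set = {(x, X). symmetric_matrix X \<and> psd (bordered_matrix x X)}"

definition rank_one :: "real^'n \<Rightarrow> real^'n^'n" where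
  "rank_one x = (\<chi> i j. x $ i * x $ j)"

type_synonym 'n cut = "(real, 'n) vec \<Rightarrow> ((real, 'n) vec, 'n) vec \<Rightarrow> real"

text \<open>Cuts are functions of \<open>(x, X)\<close>. Only the entries \<open>h $ i $ j\<close> with \<open>i < j\<close> matter.\<close>

definition linear_cut :: "('n::{finite,linorder}) cut \<Rightarrow> bool" where
  "linear_cut l \<longleftrightarrow> (\<exists>c0 b d h. \<forall>x X.
     l x X = c0 + (\<Sum>i\<in>UNIV. b $ i * x $ i) + (\<Sum>i\<in>UNIV. d $ i * X $ i $ i)
           + (\<Sum>(i, j) \<in> {(i, j). i < j}. h $ i $ j * X $ i $ j))"

definition valid_linear_cut :: "('n::{finite,linorder}) cut \<Rightarrow> bool" where
  "valid_linear_cut l \<longleftrightarrow> linear_cut l \<and> (\<forall>x \<in> unit_box. 0 \<le> l x (rank_one x))"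

text \<open>The inner product \<open>Q \<bullet> X\<close> of \<^typ>\<open>real^'n^'n\<close> is the sum of all \<open>Q $ i $ j * X $ i $ j\<close>.
  The infimum is taken in \<^typ>\<open>ereal\<close>, so an unbounded relaxation has value \<open>-\<infinity>\<close>.\<close>

definition sdp_value ::
  "real^'n^'n \<Rightarrow> real^'n \<Rightarrow> nat \<Rightarrow> (nat \<Rightarrow> 'n cut) \<Rightarrow> ereal" where
  "sdp_value Q c m L =
     (INF (x, X) \<in> {(x, X). (x, X) \<in> lifted_set \<and> (\<forall>i<m. 0 \<le> L i x X)}.
        ereal (Q \<bullet> X + c \<bullet> x))"

definition relaxation_gap ::
  "real^'n^'n \<Rightarrow> real^'n \<Rightarrow> nat \<Rightarrow> (nat \<Rightarrow> 'n cut) \<Rightarrow> ereal" where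
  "relaxation_gap Q c m L = bcqp_value Q c - sdp_value Q c m L"

end

theory Submission
  imports Defs
begin

text \<open>The four-dimensional box carries a one-parameter family of submodular quadratics, indexed by
\<open>t\<close> with \<open>1/2 \<le> t < 1\<close>,
\[q_t(x) = (x_1 + t x_2 - t x_3 - x_4)^2 + 2t\,x_1(1-x_2) + 2t\,x_3(1-x_4) - 2t(1-t)\,x_3(1-x_2),\]
that are nonnegative on the box and vanish on a monotone polygonal path from the origin to the
all-ones vertex whose two inner corners move with \<open>t\<close>. The negative last term is what makes
\<open>q_t\<close> more than a square plus products \<open>x_i (1 - x_j)\<close>: it is affordable because on the path \<open>x_3\<close>
starts to grow only after \<open>x_2\<close> has reached \<open>1\<close>.

Fix \<open>t\<close> and take the mean \<open>P\<close> of \<open>(z, z z\<^sup>T)\<close> over finitely many points \<open>z\<close> of the path. With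
\<open>v = e_2 + e_3\<close>, the vector \<open>(0, v)\<close> lies in the span of the vectors \<open>(1, z)\<close>, so \<open>\<epsilon> v v\<^sup>T\<close> may be
subtracted from the matrix part of \<open>P\<close> for small \<open>\<epsilon> > 0\<close> without leaving the semidefinite cone.
This lowers the objective from \<open>0\<close> to \<open>- 2 t (1 - t) \<epsilon>\<close>, below the box minimum \<open>0\<close>. Only a cut
that vanishes at every chosen point and decreases along \<open>- v v\<^sup>T\<close> can forbid the move
(\<open>gap_if_no_cut_blocks\<close>).

Such a cut remembers \<open>t\<close>. Each segment of the path lies in a two-dimensional face of the box,
with its midpoint in the relative interior of the face. On that face
the cut is a nonnegative quadratic in two variables that vanishes along the segment, so its
Hessian annihilates the direction of the segment and its gradient is zero. Over the three segments this forces the diagonal coefficients \<open>d_1\<close>, \<open>d_2\<close> to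
satisfy \<open>d_2 = t\<^sup>2 d_1\<close>, and it forces \<open>d_1 \<noteq> 0\<close> if the cut decreases along \<open>- v v\<^sup>T\<close>
(\<open>cut_vanishing_on_polygon\<close>). Hence a single cut blocks at most one \<open>t\<close>, and finitely many cuts
leave some \<open>t\<close> unblocked (\<open>ex_unblocked_polygon\<close>).

This gives a positive gap for every finite family of cuts. The gap is positively homogeneous in
\<open>(Q, c)\<close>, and instances carry no normalisation, so scaling turns a positive gap into one that is
at least \<open>1\<close>, and \<open>\<delta> = 1\<close> serves for all \<open>m\<close>.\<close>

section \<open>Feasible points of the relaxation below a mean of rank-one points\<close>

definition cut_slope :: "'n cut \<Rightarrow> real^'n^'n \<Rightarrow> real" where
  "cut_slope l E = l 0 E - l 0 0"

text \<open>Writing a cut as a constant plus a linear functional of the pair \<open>(x, X)\<close> lets means and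
perturbations pass through it by linearity.\<close>

lemma linear_cut_affine:
  fixes l :: "('n::{finite,linorder}) cut"
  assumes "linear_cut l"
  obtains \<phi> where "linear \<phi>" "\<And>x X. l x X = l 0 0 + \<phi> (x, X)"
proof -
  obtain c0 b d h where l: "\<And>x X. l x X = c0 + (\<Sum>i\<in>UNIV. b $ i * x $ i)
      + (\<Sum>i\<in>UNIV. d $ i * X $ i $ i) + (\<Sum>(i, j) \<in> {(i, j). i < j}. h $ i $ j * X $ i $ j)"
    using assms unfolding linear_cut_def by blast
  define \<phi> where "\<phi> = (\<lambda>p. (\<Sum>i\<in>UNIV. b $ i * fst p $ i)
      + (\<Sum>i\<in>UNIV. d $ i * snd p $ i $ i) + (\<Sum>(i, j) \<in> {(i, j). i < j}. h $ i $ j * snd p $ i $ j))"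
  have "linear \<phi>"
    by (rule linearI)
      (simp_all add: \<phi>_def algebra_simps sum.distrib sum_distrib_left case_prod_unfold)
  moreover have "l x X = l 0 0 + \<phi> (x, X)" for x X
    by (simp add: l \<phi>_def case_prod_unfold)
  ultimately show thesis using that by blast
qed

lemma cut_slope_eq:
  assumes "\<And>x X. l x X = l 0 0 + \<phi> (x, X)"
  shows "cut_slope l E = \<phi> (0, E)"
  using assms[of 0 E] by (simp add: cut_slope_def)

lemma bordered_matrix_form:
  fixes x :: "real^'n" and w :: "real^('n option)"
  defines "y \<equiv> \<chi> k. w $ Some k"
  shows "w \<bullet> (bordered_matrix x X *v w) = (w $ None)\<^sup>2 + 2 * w $ None * (y \<bullet> x) + y \<bullet> (X *v y)"
  by (simp add: bordered_matrix_def y_def inner_vec_def matrix_vector_mult_def UNIV_option_conv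
      sum.reindex algebra_simps power2_eq_square sum.distrib sum_distrib_left)

lemma inner_rank_one: "Q \<bullet> rank_one x = x \<bullet> (Q *v x)"
  by (simp add: rank_one_def inner_vec_def matrix_vector_mult_def sum_distrib_left algebra_simps)

lemma rank_one_form: "y \<bullet> (rank_one v *v y) = (y \<bullet> v)\<^sup>2"
  by (simp add: rank_one_def inner_vec_def matrix_vector_mult_def power2_eq_square sum_product 
      sum_distrib_left algebra_simps)

definition mean_point :: "(real^'n) set \<Rightarrow> real^'n" where
  "mean_point Z = (\<Sum>z\<in>Z. z) /\<^sub>R card Z"

definition mean_square :: "(real^'n) set \<Rightarrow> real^'n^'n" where
  "mean_square Z = (\<Sum>z\<in>Z. rank_one z) /\<^sub>R card Z"

text \<open>Used for the cuts, for the objective and for the quadratic form of the bordered matrix, all of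
which are affine in \<open>(x, X)\<close>.\<close>

lemma linear_mean:
  assumes "linear \<phi>"
  shows "\<phi> (mean_point Z, mean_square Z) = (\<Sum>z\<in>Z. \<phi> (z, rank_one z)) / card Z"
proof -
  have "(mean_point Z, mean_square Z) = (\<Sum>z\<in>Z. (z, rank_one z)) /\<^sub>R card Z"
    by (simp add: mean_point_def mean_square_def prod_eq_iff fst_sum snd_sum)
  then show ?thesis
    by (simp only: linear_scale[OF assms] linear_sum[OF assms]) (simp add: divide_inverse_commute)
qed

text \<open>The bordered matrix of the mean is the mean of the Gram matrices \<open>(1, z) (1, z)\<^sup>T\<close>, so its form is
a mean of squares.\<close>

lemma bordered_mean_form:
  fixes Z :: "(real^'n) set"
  assumes "finite Z" "Z \<noteq> {}"
  shows "a\<^sup>2 + 2 * a * (y \<bullet> mean_point Z) + y \<bullet> ((mean_square Z - \<epsilon> *\<^sub>R rank_one v) *v y)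
       = (\<Sum>z\<in>Z. (a + y \<bullet> z)\<^sup>2) / card Z - \<epsilon> * (y \<bullet> v)\<^sup>2"
proof -
  let ?\<phi> = "\<lambda>p :: (real^'n) \<times> (real^'n^'n). 2 * a * (y \<bullet> fst p) + y \<bullet> (snd p *v y)"
  have lin: "linear ?\<phi>"
    by (rule linearI) (simp_all add: inner_add_right matrix_vector_mult_add_rdistrib 
       scaleR_matrix_vector_assoc[symmetric] algebra_simps)
  have "a\<^sup>2 + ?\<phi> (mean_point Z, mean_square Z) = (\<Sum>z\<in>Z. a\<^sup>2 + ?\<phi> (z, rank_one z)) / card Z"
    unfolding linear_mean[OF lin] using assms by (simp add: sum.distrib field_simps)
  also have "\<dots> = (\<Sum>z\<in>Z. (a + y \<bullet> z)\<^sup>2) / card Z"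
    by (simp add: rank_one_form power2_sum algebra_simps)
  finally show ?thesis
    by (simp add: matrix_vector_mult_diff_rdistrib inner_diff_right rank_one_form
       scaleR_matrix_vector_assoc[symmetric])
qed

text \<open>If \<open>(0, v)\<close> is a combination of the vectors \<open>(1, z)\<close>, then by Cauchy-Schwarz the square
\<open>(y \<bullet> v)\<^sup>2\<close> is dominated by a multiple of the sum of the \<open>(a + y \<bullet> z)\<^sup>2\<close>. A small multiple of
\<open>v v\<^sup>T\<close> is therefore absorbed by the mean Gram matrix.\<close>

lemma mean_perturbation_in_lifted_set:
  fixes Z :: "(real^'n) set"
  assumes "finite Z" "Z \<noteq> {}" and span: "(0, v) \<in> span (Pair (1::real) ` Z)"
  shows "\<forall>\<^sub>F \<epsilon> in at_right 0. (mean_point Z, mean_square Z - \<epsilon> *\<^sub>R rank_one v) \<in> lifted_set"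
proof -
  have "span (Pair (1::real) ` Z) = range (\<lambda>u. \<Sum>p\<in>Pair 1 ` Z. u p *\<^sub>R p)"
    using \<open>finite Z\<close> by (intro span_finite) simp
  then obtain u where "(0, v) = (\<Sum>p\<in>Pair (1::real) ` Z. u p *\<^sub>R p)"
    using span by blast
  then have v: "(0, v) = (\<Sum>z\<in>Z. u (1, z) *\<^sub>R (1::real, z))"
    by (simp add: sum.reindex inj_on_def)
  define K where "K = (\<Sum>z\<in>Z. (u (1, z))\<^sup>2)"
  have "K \<ge> 0" by (simp add: K_def sum_nonneg)
  have N: "card Z > 0" using assms by (simp add: card_gt_0_iff)
  have bound: "(y \<bullet> v)\<^sup>2 \<le> K * (\<Sum>z\<in>Z. (a + y \<bullet> z)\<^sup>2)" for y a
  proof -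
    have "y \<bullet> v = (a, y) \<bullet> (0, v)" by simp
    also have "\<dots> = (\<Sum>z\<in>Z. u (1, z) * (a + y \<bullet> z))"
      unfolding v inner_sum_right by (simp add: algebra_simps)
    finally show ?thesis unfolding K_def by (simp add: Cauchy_Schwarz_ineq_sum)
  qed
  have "(mean_point Z, mean_square Z - \<epsilon> *\<^sub>R rank_one v) \<in> lifted_set"
    if \<epsilon>: "0 < \<epsilon>" "\<epsilon> < 1 / (card Z * (K + 1))" for \<epsilon>
  proof -
    have "\<epsilon> * K \<le> 1 / card Z"
    proof -
      have "\<epsilon> * K \<le> \<epsilon> * (K + 1)" using \<epsilon> by simp
      also have "\<dots> \<le> 1 / (card Z * (K + 1)) * (K + 1)"
        using \<epsilon> \<open>K \<ge> 0\<close> by (intro mult_right_mono) auto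
      also have "\<dots> = 1 / card Z" using \<open>K \<ge> 0\<close> by simp
      finally show ?thesis .
    qed
    have pos: "0 \<le> (\<Sum>z\<in>Z. (a + y \<bullet> z)\<^sup>2) / card Z - \<epsilon> * (y \<bullet> v)\<^sup>2" for a y
    proof -
      let ?S = "\<Sum>z\<in>Z. (a + y \<bullet> z)\<^sup>2"
      have "\<epsilon> * (y \<bullet> v)\<^sup>2 \<le> \<epsilon> * (K * ?S)" using \<epsilon> bound by simp
      also have "\<dots> \<le> 1 / card Z * ?S"
        using mult_right_mono[OF \<open>\<epsilon> * K \<le> 1 / card Z\<close>, of ?S] by (simp add: sum_nonneg mult.assoc)
      finally show ?thesis by simp
    qed
    have sym: "symmetric_matrix (mean_square Z - \<epsilon> *\<^sub>R rank_one v)"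
      by (simp add: symmetric_matrix_def transpose_def vec_eq_iff mean_square_def rank_one_def
          mult.commute)
    then have "symmetric_matrix (bordered_matrix (mean_point Z) (mean_square Z - \<epsilon> *\<^sub>R rank_one v))"
      by (simp add: symmetric_matrix_def transpose_def vec_eq_iff bordered_matrix_def split: option.split)
    moreover have "0 \<le> w \<bullet> (bordered_matrix (mean_point Z) (mean_square Z - \<epsilon> *\<^sub>R rank_one v) *v w)" for w
      unfolding bordered_matrix_form bordered_mean_form[OF assms(1,2)] by (rule pos)
    ultimately show ?thesis
      using sym by (simp add: lifted_set_def psd_def)
  qed
  moreover have "0 < 1 / (card Z * (K + 1))" using N \<open>K \<ge> 0\<close> by simp
  ultimately show ?thesis unfolding eventually_at_right_field by blast
qed

text \<open>Along the perturbation a cut has the value \<open>A + \<epsilon> s\<close>, where \<open>A \<ge> 0\<close> is its mean over \<open>Z\<close>. It can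
fail for small \<open>\<epsilon>\<close> only if \<open>A = 0\<close>, which by validity means that it vanishes on all of \<open>Z\<close>, and
\<open>s < 0\<close>.\<close>

lemma mean_perturbation_satisfies_cut:
  assumes "finite Z" "Z \<noteq> {}" "Z \<subseteq> unit_box" "valid_linear_cut l"
    and *: "(\<exists>z\<in>Z. l z (rank_one z) \<noteq> 0) \<or> 0 \<le> cut_slope l (- rank_one v)"
  shows "\<forall>\<^sub>F \<epsilon> in at_right 0. 0 \<le> l (mean_point Z) (mean_square Z - \<epsilon> *\<^sub>R rank_one v)"
proof -
  obtain \<phi> where lin: "linear \<phi>" and \<phi>: "\<And>x X. l x X = l 0 0 + \<phi> (x, X)"
    using assms(4) linear_cut_affine unfolding valid_linear_cut_def by blast
  define s where "s = cut_slope l (- rank_one v)"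
  have s: "s = \<phi> (0, - rank_one v)"
    unfolding s_def by (rule cut_slope_eq) (rule \<phi>)
  define A where "A = (\<Sum>z\<in>Z. l z (rank_one z)) / card Z"
  have N: "card Z > 0" using assms by (simp add: card_gt_0_iff)
  have nonneg: "0 \<le> l z (rank_one z)" if "z \<in> Z" for z
    using that assms(3,4) unfolding valid_linear_cut_def by blast
  have val: "l (mean_point Z) (mean_square Z - \<epsilon> *\<^sub>R rank_one v) = A + \<epsilon> * s" for \<epsilon>
  proof -
    have "(mean_point Z, mean_square Z - \<epsilon> *\<^sub>R rank_one v)
        = (mean_point Z, mean_square Z) + \<epsilon> *\<^sub>R (0, - rank_one v)" by simp
    then have "\<phi> (mean_point Z, mean_square Z - \<epsilon> *\<^sub>R rank_one v)
        = (\<Sum>z\<in>Z. \<phi> (z, rank_one z)) / card Z + \<epsilon> * \<phi> (0, - rank_one v)"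
      by (simp only: linear_add[OF lin] linear_scale[OF lin] linear_mean[OF lin] real_scaleR_def)
    then have "l (mean_point Z) (mean_square Z - \<epsilon> *\<^sub>R rank_one v)
        = l 0 0 + (\<Sum>z\<in>Z. \<phi> (z, rank_one z)) / card Z + \<epsilon> * s"
      using \<phi>[of "mean_point Z"] s by simp
    also have "l 0 0 + (\<Sum>z\<in>Z. \<phi> (z, rank_one z)) / card Z = A"
      unfolding A_def \<phi>[of _ "rank_one _"] using N by (simp add: sum.distrib field_simps)
    finally show ?thesis .
  qed
  have "0 \<le> A" unfolding A_def by (simp add: nonneg sum_nonneg)
  from * consider "0 < A" | "0 \<le> s"
  proof
    assume "\<exists>z\<in>Z. l z (rank_one z) \<noteq> 0"
    then obtain z where "z \<in> Z" "0 < l z (rank_one z)" using nonneg by force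
    then have "0 < (\<Sum>z\<in>Z. l z (rank_one z))"
      using assms(1) nonneg by (intro sum_pos2[of Z z]) auto
    then show thesis using N that(1) by (simp add: A_def)
  qed (use that(2) s_def in simp)
  then show ?thesis unfolding val
  proof cases
    case 1
    have "((\<lambda>\<epsilon>. A + \<epsilon> * s) \<longlongrightarrow> A + 0 * s) (at_right 0)" by (intro tendsto_intros)
    then have "\<forall>\<^sub>F \<epsilon> in at_right 0. 0 < A + \<epsilon> * s" using 1 by (auto dest: order_tendstoD(1))
    then show "\<forall>\<^sub>F \<epsilon> in at_right 0. 0 \<le> A + \<epsilon> * s" by (rule eventually_mono) simp
  next
    case 2
    then show "\<forall>\<^sub>F \<epsilon> in at_right 0. 0 \<le> A + \<epsilon> * s"
      using \<open>0 \<le> A\<close> by (auto simp: eventually_at_right_field intro!: exI[of _ 1])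
  qed
qed

section \<open>Gaps from unblocked directions\<close>

text \<open>One feasible point with negative objective suffices: the factor \<open>r\<close> moves its objective to \<open>-1\<close>,
while the box minimum stays nonnegative.\<close>

lemma scaled_gap_ge_one:
  assumes "submodular_instance Q c"
    and nonneg: "\<forall>y\<in>unit_box. 0 \<le> y \<bullet> (Q *v y) + c \<bullet> y"
    and "(x, X) \<in> lifted_set" "\<forall>i<m. 0 \<le> L i x X" and neg: "Q \<bullet> X + c \<bullet> x < 0"
  shows "\<exists>Q' c'. submodular_instance Q' c' \<and> 1 \<le> relaxation_gap Q' c' m L"
proof (intro exI conjI)
  define r where "r = - 1 / (Q \<bullet> X + c \<bullet> x)"
  have "r > 0" using neg by (simp add: r_def field_simps)
  show "submodular_instance (r *\<^sub>R Q) (r *\<^sub>R c)"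
    using assms(1) \<open>r > 0\<close>
    by (auto simp: submodular_instance_def symmetric_matrix_def transpose_def vec_eq_iff mult_nonneg_nonpos)
  have "0 \<le> y \<bullet> ((r *\<^sub>R Q) *v y) + (r *\<^sub>R c) \<bullet> y" if "y \<in> unit_box" for y
    using mult_nonneg_nonneg[OF less_imp_le[OF \<open>r > 0\<close>] bspec[OF nonneg that]]
    by (simp add: scaleR_matrix_vector_assoc[symmetric] distrib_left)
  then have "0 \<le> bcqp_value (r *\<^sub>R Q) (r *\<^sub>R c)"
    unfolding bcqp_value_def by (intro INF_greatest) (simp add: zero_ereal_def)
  moreover have "sdp_value (r *\<^sub>R Q) (r *\<^sub>R c) m L \<le> -1"
  proof -
    have "sdp_value (r *\<^sub>R Q) (r *\<^sub>R c) m L \<le> ereal ((r *\<^sub>R Q) \<bullet> X + (r *\<^sub>R c) \<bullet> x)"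
      unfolding sdp_value_def using assms(3,4) by (intro INF_lower2[of "(x, X)"]) auto
    also have "(r *\<^sub>R Q) \<bullet> X + (r *\<^sub>R c) \<bullet> x = r * (Q \<bullet> X + c \<bullet> x)"
      by (simp add: algebra_simps)
    also have "r * (Q \<bullet> X + c \<bullet> x) = -1" using neg by (simp add: r_def)
    finally show ?thesis by (simp add: one_ereal_def)
  qed
  ultimately have "0 - (-1) \<le> relaxation_gap (r *\<^sub>R Q) (r *\<^sub>R c) m L"
    unfolding relaxation_gap_def by (rule ereal_minus_mono)
  then show "1 \<le> relaxation_gap (r *\<^sub>R Q) (r *\<^sub>R c) m L" by simp
qed

lemma gap_if_no_cut_blocks:
  fixes L :: "nat \<Rightarrow> ('n::{finite,linorder}) cut"
  assumes Q: "submodular_instance Q c"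
    and nonneg: "\<forall>y\<in>unit_box. 0 \<le> y \<bullet> (Q *v y) + c \<bullet> y"
    and Z: "finite Z" "Z \<noteq> {}" "Z \<subseteq> unit_box"
    and zeros: "\<And>z. z \<in> Z \<Longrightarrow> z \<bullet> (Q *v z) + c \<bullet> z = 0"
    and v: "(0, v) \<in> span (Pair (1::real) ` Z)" "0 < v \<bullet> (Q *v v)"
    and valid: "\<And>i. i < m \<Longrightarrow> valid_linear_cut (L i)"
    and unblocked: "\<And>i. i < m \<Longrightarrow>
      (\<exists>z\<in>Z. L i z (rank_one z) \<noteq> 0) \<or> 0 \<le> cut_slope (L i) (- rank_one v)"
  shows "\<exists>Q' c'. submodular_instance Q' c' \<and> 1 \<le> relaxation_gap Q' c' m L"
proof -
  have "\<forall>\<^sub>F \<epsilon> in at_right 0. \<forall>i\<in>{..<m}. 0 \<le> L i (mean_point Z) (mean_square Z - \<epsilon> *\<^sub>R rank_one v)"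
    using mean_perturbation_satisfies_cut[OF Z valid unblocked]
    by (intro eventually_ball_finite) auto
  then have "\<forall>\<^sub>F \<epsilon> in at_right 0. \<epsilon> > 0 \<and>
      (mean_point Z, mean_square Z - \<epsilon> *\<^sub>R rank_one v) \<in> lifted_set \<and>
      (\<forall>i\<in>{..<m}. 0 \<le> L i (mean_point Z) (mean_square Z - \<epsilon> *\<^sub>R rank_one v))"
    by (intro eventually_conj eventually_at_right_less mean_perturbation_in_lifted_set Z v)
  from eventually_happens[OF this] obtain \<epsilon> :: real where "\<epsilon> > 0"
    and lifted: "(mean_point Z, mean_square Z - \<epsilon> *\<^sub>R rank_one v) \<in> lifted_set"
    and cuts: "\<forall>i<m. 0 \<le> L i (mean_point Z) (mean_square Z - \<epsilon> *\<^sub>R rank_one v)"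
    by auto
  let ?\<phi> = "\<lambda>p. Q \<bullet> snd p + c \<bullet> fst p"
  have "linear ?\<phi>" by (rule linearI) (simp_all add: algebra_simps)
  from linear_mean[OF this, of Z] have "Q \<bullet> mean_square Z + c \<bullet> mean_point Z = 0"
    by (simp add: inner_rank_one zeros)
  then have "Q \<bullet> (mean_square Z - \<epsilon> *\<^sub>R rank_one v) + c \<bullet> mean_point Z = - \<epsilon> * (v \<bullet> (Q *v v))"
    by (simp add: inner_diff_right inner_rank_one)
  also have "\<dots> < 0" using \<open>\<epsilon> > 0\<close> v(2) by simp
  finally show ?thesis 
    by (rule scaled_gap_ge_one[where Q = Q and c = c and L = L and x = "mean_point Z"
        and X = "mean_square Z - \<epsilon> *\<^sub>R rank_one v", OF Q nonneg lifted cuts])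
qed

section \<open>Nonnegative quadratics that vanish on a segment\<close>

lemma linear_term_zero_if_nonneg_near_zero:
  fixes g a \<eta> :: real
  assumes "\<eta> > 0" and nonneg: "\<And>\<tau>. \<bar>\<tau>\<bar> \<le> \<eta> \<Longrightarrow> 0 \<le> g * \<tau> + a * \<tau>\<^sup>2"
  shows "g = 0"
proof (rule ccontr)
  assume "g \<noteq> 0"
  define \<tau> where "\<tau> = min \<eta> (\<bar>g\<bar> / (2 * (\<bar>a\<bar> + 1)))"
  have "\<tau> > 0" using \<open>\<eta> > 0\<close> \<open>g \<noteq> 0\<close> by (simp add: \<tau>_def)
  have "\<tau> * (\<bar>a\<bar> + 1) \<le> \<bar>g\<bar> / 2"
  proof -
    have "\<tau> \<le> \<bar>g\<bar> / (2 * (\<bar>a\<bar> + 1))" by (simp add: \<tau>_def)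
    then show ?thesis by (simp add: field_simps)
  qed
  then have "\<bar>a\<bar> * \<tau> < \<bar>g\<bar>" using \<open>\<tau> > 0\<close> \<open>g \<noteq> 0\<close> by (simp add: algebra_simps)
  then have "a * \<tau> < \<bar>g\<bar>" using \<open>\<tau> > 0\<close>
    by (metis abs_ge_self less_eq_real_def mult_right_mono order_le_less_trans)
  then have "\<tau> * (a * \<tau>) < \<tau> * \<bar>g\<bar>" using \<open>\<tau> > 0\<close> by simp
  moreover have "\<bar>- sgn g * \<tau>\<bar> \<le> \<eta>" using \<open>g \<noteq> 0\<close> \<open>\<tau> > 0\<close> by (simp add: abs_mult abs_sgn_eq \<tau>_def)
  from nonneg[OF this] have "0 \<le> - \<bar>g\<bar> * \<tau> + a * \<tau>\<^sup>2"
    using \<open>g \<noteq> 0\<close> by (simp add: power_mult_distrib abs_sgn mult.assoc sgn_if split: if_splits)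
  ultimately show False by (simp add: power2_eq_square algebra_simps)
qed

text \<open>At a zero \<open>(x, y)\<close> with nonnegativity nearby, the gradient vanishes and the Hessian is positive
semidefinite. A second zero in the direction \<open>(p, r)\<close> makes the Hessian form vanish there, so
\<open>(p, r)\<close> lies in its kernel.\<close>

lemma quadratic_zero_on_segment:
  fixes f :: "real \<Rightarrow> real \<Rightarrow> real"
  assumes f: "\<And>x y. f x y = a * x\<^sup>2 + b * x * y + c * y\<^sup>2 + d * x + e * y + k"
    and "\<eta> > 0"
    and nonneg: "\<And>u w. \<bar>u\<bar> \<le> \<eta> \<and> \<bar>w\<bar> \<le> \<eta> \<longrightarrow> 0 \<le> f (x + u) (y + w)"
    and "f x y = 0" "f (x + p) (y + r) = 0"
  shows "2 * a * x + b * y + d = 0" "b * x + 2 * c * y + e = 0"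
    and "2 * a * p + b * r = 0" "b * p + 2 * c * r = 0"
proof -
  let ?gx = "2 * a * x + b * y + d" and ?gy = "b * x + 2 * c * y + e"
  let ?H = "\<lambda>u w. a * u\<^sup>2 + b * u * w + c * w\<^sup>2"
  have exp: "f (x + u) (y + w) = ?gx * u + ?gy * w + ?H u w" for u w
    using \<open>f x y = 0\<close> unfolding f by (simp add: power2_eq_square algebra_simps)
  show gx: "?gx = 0"
    by (rule linear_term_zero_if_nonneg_near_zero[OF \<open>\<eta> > 0\<close>, of _ a])
      (use nonneg[of _ 0] exp[of _ 0] \<open>\<eta> > 0\<close> in simp)
  show gy: "?gy = 0"
    by (rule linear_term_zero_if_nonneg_near_zero[OF \<open>\<eta> > 0\<close>, of _ c])
      (use nonneg[of 0] exp[of 0] \<open>\<eta> > 0\<close> in simp)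
  have H: "0 \<le> ?H u w" for u w
  proof -
    define \<sigma> where "\<sigma> = \<eta> / (\<bar>u\<bar> + \<bar>w\<bar> + 1)"
    have "\<sigma> > 0" using \<open>\<eta> > 0\<close> by (simp add: \<sigma>_def)
    have "\<bar>\<sigma> * u\<bar> \<le> \<eta>" "\<bar>\<sigma> * w\<bar> \<le> \<eta>"
      using \<open>\<eta> > 0\<close> by (simp_all add: \<sigma>_def abs_mult field_simps)
    with nonneg have "0 \<le> ?H (\<sigma> * u) (\<sigma> * w)" unfolding exp gx gy by simp
    also have "?H (\<sigma> * u) (\<sigma> * w) = \<sigma>\<^sup>2 * ?H u w" by (simp add: power2_eq_square algebra_simps)
    finally show ?thesis using \<open>\<sigma> > 0\<close> by (simp add: zero_le_mult_iff)
  qed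
  have H0: "?H p r = 0" using \<open>f (x + p) (y + r) = 0\<close> unfolding exp gx gy by simp
  have split: "?H (p + u) (r + w) = (2 * a * p + b * r) * u + (b * p + 2 * c * r) * w + ?H u w" for u w
    using H0 by (simp add: power2_eq_square algebra_simps)
  show "2 * a * p + b * r = 0"
    by (rule linear_term_zero_if_nonneg_near_zero[of 1 _ a])
      (use H[of "p + _" r] split[of _ 0] in simp_all)
  show "b * p + 2 * c * r = 0"
    by (rule linear_term_zero_if_nonneg_near_zero[of 1 _ c])
      (use H[of p "r + _"] split[of 0] in simp_all)
qed

text \<open>In the coordinates \<open>a = 1 - x_2\<close>, \<open>b = x_1\<close>, \<open>c = x_3\<close>, \<open>e = 1 - x_4\<close>, which display the symmetry
\<open>(a, b) \<leftrightarrow> (c, e)\<close>, let \<open>h\<close> be the linear form that is squared and \<open>\<mu> = min a c\<close>. The products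
satisfy \<open>a b + c e \<ge> \<mu> (b + e)\<close>, where \<open>b + e = h + t (a + c) + (1 - t)\<close>, and \<open>a c \<le> \<mu>\<close>. The
contribution \<open>2 t (1 - t) \<mu>\<close> of the constant cancels the negative term, and what remains is at
least \<open>(h + t \<mu>)\<^sup>2 + 3 (t \<mu>)\<^sup>2\<close>.\<close>

lemma polygon_quadratic_nonneg:
  fixes t a b c e :: real
  assumes t: "1/2 \<le> t" "t < 1" and "0 \<le> a" "a \<le> 1" "0 \<le> b" "0 \<le> c" "c \<le> 1" "0 \<le> e"
  shows "0 \<le> (b + e - t * (a + c) - (1 - t))\<^sup>2 + 2 * t * (a * b + c * e) - 2 * t * (1 - t) * (a * c)"
proof -
  define h where "h = b + e - t * (a + c) - (1 - t)"
  define \<mu> where "\<mu> = min a c"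
  have \<mu>: "0 \<le> \<mu>" "\<mu> \<le> a" "\<mu> \<le> c" using assms by (auto simp: \<mu>_def)
  have "a * c \<le> \<mu>"
    using assms by (auto simp: \<mu>_def min_def mult_left_le mult_left_le_one_le)
  have "\<mu> * (b + e) \<le> a * b + c * e"
    using \<mu> assms by (simp add: distrib_left add_mono mult_right_mono)
  then have "\<mu> * (h + 2 * t * \<mu> + (1 - t)) \<le> a * b + c * e"
  proof (rule order_trans[rotated])
    have "t * (2 * \<mu>) \<le> t * (a + c)" using \<mu> t by (intro mult_left_mono) auto
    then show "\<mu> * (h + 2 * t * \<mu> + (1 - t)) \<le> \<mu> * (b + e)"
      using \<mu> by (intro mult_left_mono) (auto simp: h_def)
  qed
  then have "2 * t * (\<mu> * (h + 2 * t * \<mu> + (1 - t))) \<le> 2 * t * (a * b + c * e)"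
    using t by (intro mult_left_mono) auto
  moreover have "2 * t * (1 - t) * (a * c) \<le> 2 * t * (1 - t) * \<mu>"
    using \<open>a * c \<le> \<mu>\<close> t by (intro mult_left_mono) auto
  moreover have "0 \<le> (h + t * \<mu>)\<^sup>2 + 3 * (t * \<mu>)\<^sup>2" by simp
  ultimately show ?thesis
    unfolding h_def[symmetric] by (simp add: power2_eq_square algebra_simps)
qed

text \<open>The hypotheses list the corners and the midpoints of the segments of the path. Its segments lie
in the faces \<open>x1 = x3 = 0\<close>, then \<open>x2 = 1, x3 = 0\<close>, then \<open>x2 = x4 = 1\<close>, and the kernel conditions
of \<open>quadratic_zero_on_segment\<close> in these three faces tie \<open>d2\<close> to \<open>d4\<close>, \<open>d4\<close> to \<open>d1\<close> and \<open>d3\<close> to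
\<open>d1\<close>. If \<open>d1 = 0\<close>, only bilinear and linear terms are left, and the value at the vertex
\<open>(0, 0, 1, 1)\<close> turns out to be \<open>- g23\<close>.\<close>

lemma zeros_determine_quadratic:
  fixes F :: "real \<Rightarrow> real \<Rightarrow> real \<Rightarrow> real \<Rightarrow> real"
  assumes F: "\<And>x1 x2 x3 x4. F x1 x2 x3 x4 = c0 + b1*x1 + b2*x2 + b3*x3 + b4*x4
     + d1*x1\<^sup>2 + d2*x2\<^sup>2 + d3*x3\<^sup>2 + d4*x4\<^sup>2
     + g12*x1*x2 + g13*x1*x3 + g14*x1*x4 + g23*x2*x3 + g24*x2*x4 + g34*x3*x4"
    and t: "0 < t" "t < 1"
    and nonneg: "\<forall>x1\<in>{0..1}. \<forall>x2\<in>{0..1}. \<forall>x3\<in>{0..1}. \<forall>x4\<in>{0..1}. 0 \<le> F x1 x2 x3 x4"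
    and zero: "F 0 0 0 0 = 0" "F 0 (1/2) 0 (t/2) = 0" "F 0 1 0 t = 0"
      "F ((1-t)/2) 1 0 ((1+t)/2) = 0" "F (1-t) 1 0 1 = 0" 
      "F (1-t/2) 1 (1/2) 1 = 0" "F 1 1 1 1 = 0"
  shows "d2 = t\<^sup>2 * d1" and "d1 = 0 \<Longrightarrow> 0 \<le> - d2 - d3 - g23"
proof -
  \<comment> \<open>a radius by which all three midpoints keep their distance from the boundary of their faces\<close>
  define \<eta> where "\<eta> = min t (1 - t) / 2"
  have \<eta>: "0 < \<eta>" "\<eta> \<le> 1/4" "\<eta> \<le> t/2" "\<eta> \<le> (1-t)/2" using t by (auto simp: \<eta>_def min_def)
  have f1: "F 0 x 0 y = d2 * x\<^sup>2 + g24 * x * y + d4 * y\<^sup>2 + b2 * x + b4 * y + c0" for x y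
    by (simp add: F)
  have f2: "F x 1 0 y = d1 * x\<^sup>2 + g14 * x * y + d4 * y\<^sup>2 + (b1 + g12) * x + (b4 + g24) * y
      + (c0 + b2 + d2)" for x y
    by (simp add: F algebra_simps)
  have f3: "F x 1 y 1 = d1 * x\<^sup>2 + g13 * x * y + d3 * y\<^sup>2 + (b1 + g12 + g14) * x
      + (b3 + g23 + g34) * y + (c0 + b2 + d2 + b4 + d4 + g24)" for x y
    by (simp add: F algebra_simps)
  have n1: "\<bar>u\<bar> \<le> \<eta> \<and> \<bar>w\<bar> \<le> \<eta> \<longrightarrow> 0 \<le> F 0 (1/2 + u) 0 (t/2 + w)" for u w
    using \<eta> t by (intro impI nonneg[rule_format]) (auto simp: abs_le_iff)
  have n2: "\<bar>u\<bar> \<le> \<eta> \<and> \<bar>w\<bar> \<le> \<eta> \<longrightarrow> 0 \<le> F ((1-t)/2 + u) 1 0 ((1+t)/2 + w)" for u w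
    using \<eta> t by (intro impI nonneg[rule_format]) (auto simp: abs_le_iff field_simps)
  have n3: "\<bar>u\<bar> \<le> \<eta> \<and> \<bar>w\<bar> \<le> \<eta> \<longrightarrow> 0 \<le> F (1-t/2 + u) 1 (1/2 + w) 1" for u w
    using \<eta> t by (intro impI nonneg[rule_format]) (auto simp: abs_le_iff)
  have e1: "F 0 (1/2 + 1/2) 0 (t/2 + t/2) = 0" using zero by simp
  have e2: "F ((1-t)/2 + (1-t)/2) 1 0 ((1+t)/2 + (1-t)/2) = 0" 
  proof -
    have "(1-t)/2 + (1-t)/2 = 1-t" "(1+t)/2 + (1-t)/2 = 1" by (simp_all add: field_simps)
    then show ?thesis using zero by simp
  qed
  have e3: "F (1-t/2 + t/2) 1 (1/2 + 1/2) 1 = 0" using zero by simp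
  note q1 = quadratic_zero_on_segment[OF f1 \<eta>(1) n1 zero(2) e1]
  note q2 = quadratic_zero_on_segment[OF f2 \<eta>(1) n2 zero(4) e2]
  note q3 = quadratic_zero_on_segment[OF f3 \<eta>(1) n3 zero(6) e3]
  have g24: "d2 = - t * g24 / 2" "g24 = - 2 * t * d4"
    using q1(3,4) by (argo, argo)
  have "(2 * d1 + g14) * (1 - t) = 0" "(g14 + 2 * d4) * (1 - t) = 0"
    using q2(3,4) by (simp_all add: field_simps)
  then have g14: "g14 = - 2 * d1" "d4 = d1" using t by auto
  show d2: "d2 = t\<^sup>2 * d1" using g24 g14 by (simp add: power2_eq_square)
  have "g13 = - 2 * t * d1" "d3 = - t * g13 / 2"
    using q3(3,4) by (argo, argo)
  then have g13: "g13 = - 2 * t * d1" "d3 = t\<^sup>2 * d1" by (simp_all add: power2_eq_square)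
  assume "d1 = 0"
  then have zeros: "d2 = 0" "d3 = 0" "d4 = 0" "g24 = 0" "g14 = 0" "g13 = 0" "c0 = 0"
    using d2 g13 g14 g24 zero(1) by (simp_all add: F)
  with q1(2) q3(2) have "b4 = 0" "b3 + g23 + g34 = 0" by auto
  with nonneg[rule_format, of 0 0 1 1] show "0 \<le> - d2 - d3 - g23" using zeros by (simp add: F)
qed

section \<open>Submodular instances that vanish on a monotone polygonal path\<close>

lemma vector_4:
  "(vector [x, y, z, w] :: ('a::zero)^4) $ 1 = x"
  "(vector [x, y, z, w] :: ('a::zero)^4) $ 2 = y"
  "(vector [x, y, z, w] :: ('a::zero)^4) $ 3 = z"
  "(vector [x, y, z, w] :: ('a::zero)^4) $ 4 = w"
  unfolding vector_def by simp_all

text \<open>The pair \<open>polygon_Q t\<close>, \<open>polygon_c t\<close> encodes the quadratic \<open>q_t\<close>; see \<open>polygon_objective\<close>. The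
coefficients \<open>2 t\<close> of \<open>x_1 (1 - x_2)\<close> and \<open>x_3 (1 - x_4)\<close> are the least ones that cancel the
positive cross terms of the square.\<close>

definition polygon_Q :: "real \<Rightarrow> real^4^4" where
  "polygon_Q t = vector
    [vector [1, 0, - t, -1],
     vector [0, t\<^sup>2, t - 2 * t\<^sup>2, - t],
     vector [- t, t - 2 * t\<^sup>2, t\<^sup>2, 0],
     vector [-1, - t, 0, 1]]"

definition polygon_c :: "real \<Rightarrow> real^4" where
  "polygon_c t = vector [2 * t, 0, 2 * t\<^sup>2, 0]"

text \<open>The corners \<open>(0,0,0,0)\<close>, \<open>(0,1,0,t)\<close>, \<open>(1-t,1,0,1)\<close>, \<open>(1,1,1,1)\<close> of the path, with the midpoint
of each of its segments inserted between them.\<close>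

definition polygon_points :: "real \<Rightarrow> (real^4) set" where
  "polygon_points t =
    {vector [0, 0, 0, 0], vector [0, 1/2, 0, t/2],
     vector [0, 1, 0, t], vector [(1-t)/2, 1, 0, (1+t)/2],
     vector [1-t, 1, 0, 1], vector [1-t/2, 1, 1/2, 1], vector [1, 1, 1, 1]}"

text \<open>The move subtracts a multiple of \<open>v v\<^sup>T\<close> for this \<open>v\<close>. It leaves \<open>X_{12}\<close> and \<open>X_{34}\<close> and, as \<open>v\<close>
is orthogonal to \<open>(1, t, -t, -1)\<close>, the value of the squared linear form as they are, and it lowers
\<open>X_{23}\<close>, so that only \<open>x_3 (1 - x_2)\<close> changes.\<close>

definition escape_direction :: "real^4" where
  "escape_direction = vector [0, 1, 1, 0]"

lemma polygon_objective:
  "x \<bullet> (polygon_Q t *v x) + polygon_c t \<bullet> x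
   = (x$1 + t * x$2 - t * x$3 - x$4)\<^sup>2 + 2 * t * (x$1 * (1 - x$2)) + 2 * t * (x$3 * (1 - x$4))
     - 2 * t * (1 - t) * (x$3 * (1 - x$2))"
  by (simp add: polygon_Q_def polygon_c_def inner_vec_def matrix_vector_mult_def sum_4 vector_4
      power2_eq_square algebra_simps)

lemma submodular_polygon_instance:
  assumes "1/2 \<le> t"
  shows "submodular_instance (polygon_Q t) (polygon_c t)"
proof -
  have "t - 2 * t\<^sup>2 \<le> 0"
    using mult_right_mono[of "1/2" t t] assms by (simp add: power2_eq_square)
  then show ?thesis
    using assms by (simp add: submodular_instance_def symmetric_matrix_def transpose_def vec_eq_iff
      forall_4 polygon_Q_def vector_4)
qed

lemma polygon_objective_nonneg:
  assumes "1/2 \<le> t" "t < 1" "x \<in> unit_box"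
  shows "0 \<le> x \<bullet> (polygon_Q t *v x) + polygon_c t \<bullet> x"
  using polygon_quadratic_nonneg[of t "1 - x$2" "x$1" "x$3" "1 - x$4"] assms
  unfolding polygon_objective unit_box_def by (simp add: algebra_simps)

lemma polygon_points_subset_unit_box:
  assumes "0 < t" "t < 1"
  shows "polygon_points t \<subseteq> unit_box"
  using assms by (auto simp: polygon_points_def unit_box_def forall_4 vector_4)

lemma polygon_objective_zero:
  assumes "z \<in> polygon_points t"
  shows "z \<bullet> (polygon_Q t *v z) + polygon_c t \<bullet> z = 0"
  using assms unfolding polygon_objective polygon_points_def
  by (auto simp: vector_4 power2_eq_square field_simps)

lemma escape_direction_form: "escape_direction \<bullet> (polygon_Q t *v escape_direction) = 2 * t * (1 - t)"
  by (simp add: polygon_Q_def escape_direction_def inner_vec_def matrix_vector_mult_def sum_4 vector_4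
      power2_eq_square algebra_simps)

lemma escape_direction_in_span:
  assumes "t < 1"
  shows "(0, escape_direction) \<in> span (Pair (1::real) ` polygon_points t)"
proof -
  let ?p = "\<lambda>z :: real^4. (1::real, z)"
  have mem: "?p z \<in> span (?p ` polygon_points t)" if "z \<in> polygon_points t" for z
    using that by (intro span_base) simp
  define k where "k = 1 / (1 - t)"
  have "k * (1 - t) = 1" using assms by (simp add: k_def)
  then have "(0, escape_direction) = ?p (vector [1, 1, 1, 1]) - ?p (vector [0, 0, 0, 0])
      + k *\<^sub>R (?p (vector [0, 1, 0, t]) - ?p (vector [1-t, 1, 0, 1]))"
    by (simp add: escape_direction_def vec_eq_iff forall_4 vector_4 algebra_simps)
  also have "\<dots> \<in> span (?p ` polygon_points t)"
    by (intro span_add span_diff span_scale mem) (simp_all add: polygon_points_def)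
  finally show ?thesis .
qed

section \<open>A cut blocks at most one path\<close>

lemma sum_strict_pairs:
  fixes f :: "'n::{finite,linorder} \<Rightarrow> 'n \<Rightarrow> real"
  shows "(\<Sum>(i, j) \<in> {(i, j). i < j}. f i j) = (\<Sum>i\<in>UNIV. \<Sum>j\<in>UNIV. if i < j then f i j else 0)"
  unfolding sum.cartesian_product case_prod_unfold
  by (rule sum.mono_neutral_cong_left) auto

text \<open>The diagonal coefficients \<open>d_1\<close> and \<open>d_2\<close> of the cut appear as its slopes along \<open>e_1 e_1\<^sup>T\<close> and
\<open>e_2 e_2\<^sup>T\<close>, so that the statement does not depend on the choice of coefficients.\<close>

lemma cut_vanishing_on_polygon:
  fixes l :: "4 cut"
  assumes t: "0 < t" "t < 1" and l: "valid_linear_cut l"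
    and zero: "\<And>z. z \<in> polygon_points t \<Longrightarrow> l z (rank_one z) = 0"
  shows "cut_slope l (rank_one (axis 2 1)) = t\<^sup>2 * cut_slope l (rank_one (axis 1 1))"
    and "cut_slope l (rank_one (axis 1 1)) = 0 \<Longrightarrow> 0 \<le> cut_slope l (- rank_one escape_direction)"
proof -
  obtain c0 b d h where "\<And>x X. l x X = c0 + (\<Sum>i\<in>UNIV. b $ i * x $ i)
      + (\<Sum>i\<in>UNIV. d $ i * X $ i $ i) + (\<Sum>(i, j) \<in> {(i, j). i < j}. h $ i $ j * X $ i $ j)"
    using l unfolding valid_linear_cut_def linear_cut_def by blast
  note lx = this[unfolded sum_strict_pairs]
  \<comment> \<open>the coefficient of an unordered pair: whatever the order of the index type, one summand is zero\<close>
  define g where "g i j = (if i < j then h $ i $ j else 0) + (if j < i then h $ j $ i else 0)" for i j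
  have val: "l x X = c0 + b$1*x$1 + b$2*x$2 + b$3*x$3 + b$4*x$4
      + d$1*X$1$1 + d$2*X$2$2 + d$3*X$3$3 + d$4*X$4$4
      + g 1 2*X$1$2 + g 1 3*X$1$3 + g 1 4*X$1$4 + g 2 3*X$2$3 + g 2 4*X$2$4 + g 3 4*X$3$4"
    if "\<And>i j. X$i$j = X$j$i" for x X
    unfolding lx g_def sum_4 using that[of 1 2] that[of 1 3] that[of 1 4] that[of 2 3] that[of 2 4] that[of 3 4]
    by (simp add: algebra_simps)
  define F where "F x1 x2 x3 x4 = c0 + b$1*x1 + b$2*x2 + b$3*x3 + b$4*x4
     + d$1*x1\<^sup>2 + d$2*x2\<^sup>2 + d$3*x3\<^sup>2 + d$4*x4\<^sup>2
     + g 1 2*x1*x2 + g 1 3*x1*x3 + g 1 4*x1*x4 + g 2 3*x2*x3 + g 2 4*x2*x4 + g 3 4*x3*x4"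
    for x1 x2 x3 x4
  have F: "l z (rank_one z) = F (z$1) (z$2) (z$3) (z$4)" for z
    by (subst val) (simp_all add: rank_one_def F_def power2_eq_square)
  have nonneg: "\<forall>x1\<in>{0..1}. \<forall>x2\<in>{0..1}. \<forall>x3\<in>{0..1}. \<forall>x4\<in>{0..1}. 0 \<le> F x1 x2 x3 x4"
  proof (intro ballI)
    fix x1 x2 x3 x4 :: real
    assume "x1 \<in> {0..1}" "x2 \<in> {0..1}" "x3 \<in> {0..1}" "x4 \<in> {0..1}"
    then have "vector [x1, x2, x3, x4] \<in> (unit_box :: (real^4) set)"
      by (simp add: unit_box_def forall_4 vector_4)
    with l show "0 \<le> F x1 x2 x3 x4"
      unfolding valid_linear_cut_def F by (metis vector_4)
  qed
  have zeros: "F 0 0 0 0 = 0" "F 0 (1/2) 0 (t/2) = 0" "F 0 1 0 t = 0"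
      "F ((1-t)/2) 1 0 ((1+t)/2) = 0" "F (1-t) 1 0 1 = 0"
      "F (1-t/2) 1 (1/2) 1 = 0" "F 1 1 1 1 = 0"
  proof -
    have "\<forall>z\<in>polygon_points t. F (z$1) (z$2) (z$3) (z$4) = 0" using zero unfolding F by blast
    then show "F 0 0 0 0 = 0" "F 0 (1/2) 0 (t/2) = 0" "F 0 1 0 t = 0"
      "F ((1-t)/2) 1 0 ((1+t)/2) = 0" "F (1-t) 1 0 1 = 0"
      "F (1-t/2) 1 (1/2) 1 = 0" "F 1 1 1 1 = 0"
      by (simp_all add: polygon_points_def vector_4)
  qed
  note determined = zeros_determine_quadratic[OF F_def t nonneg zeros]
  have slopes: "cut_slope l (rank_one (axis 1 1)) = d$1" "cut_slope l (rank_one (axis 2 1)) = d$2"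
      "cut_slope l (- rank_one escape_direction) = - d$2 - d$3 - g 2 3"
    unfolding cut_slope_def
    by (subst (1 2) val; simp add: rank_one_def axis_def escape_direction_def vector_4)+
  show "cut_slope l (rank_one (axis 2 1)) = t\<^sup>2 * cut_slope l (rank_one (axis 1 1))"
    unfolding slopes by (rule determined(1))
  show "0 \<le> cut_slope l (- rank_one escape_direction)" if "cut_slope l (rank_one (axis 1 1)) = 0"
    using that unfolding slopes by (rule determined(2))
qed

text \<open>A blocking cut has \<open>d_1 \<noteq> 0\<close> and \<open>d_2 = t\<^sup>2 d_1\<close>, so it determines \<open>t\<close>. If every \<open>t\<close> were blocked,
choosing a blocking cut would inject an interval into the finite set of cuts.\<close>

lemma ex_unblocked_polygon:
  fixes L :: "nat \<Rightarrow> 4 cut"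
  assumes valid: "\<And>i. i < m \<Longrightarrow> valid_linear_cut (L i)"
  obtains t where "1/2 \<le> t" "t < 1"
    "\<And>i. i < m \<Longrightarrow> (\<exists>z\<in>polygon_points t. L i z (rank_one z) \<noteq> 0)
      \<or> 0 \<le> cut_slope (L i) (- rank_one escape_direction)"
proof -
  define blocks where "blocks i t \<longleftrightarrow> (\<forall>z\<in>polygon_points t. L i z (rank_one z) = 0)
      \<and> cut_slope (L i) (- rank_one escape_direction) < 0" for i t
  have unique: "t = t'" if "i < m" "blocks i t" "blocks i t'" "t \<in> {1/2..<1}" "t' \<in> {1/2..<1}" for i t t'
  proof -
    let ?d = "\<lambda>k. cut_slope (L i) (rank_one (axis k 1))"
    have *: "?d 2 = s\<^sup>2 * ?d 1 \<and> ?d 1 \<noteq> 0" if "blocks i s" "s \<in> {1/2..<1}" for s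
      using cut_vanishing_on_polygon[of s "L i"] valid[OF \<open>i < m\<close>] that
      unfolding blocks_def by force
    have "t\<^sup>2 = t'\<^sup>2" using *[of t] *[of t'] that by simp
    then show ?thesis using that by (simp add: power2_eq_iff_nonneg)
  qed
  have "\<exists>t\<in>{1/2..<1}. \<forall>i<m. \<not> blocks i t"
  proof (rule ccontr)
    assume "\<not> ?thesis"
    then obtain f where f: "\<And>t. t \<in> {1/2..<1} \<Longrightarrow> f t < m \<and> blocks (f t) t" by metis
    have "inj_on f {1/2..<1}"
      by (rule inj_onI) (metis f unique)
    moreover have "finite (f ` {1/2..<1})"
      by (rule finite_subset[of _ "{..<m}"]) (use f in auto)
    ultimately have "finite {1/2..<1::real}" by (simp add: finite_image_iff)
    then show False using infinite_Ico[of "1/2" "1::real"] by simp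
  qed
  then show thesis using that unfolding blocks_def by (metis atLeastLessThan_iff not_less)
qed

section \<open>Every finite family of cuts leaves a gap\<close>

theorem theorem2:
  shows "\<exists>\<delta>::real. 0 < \<delta> \<and>
    (\<forall>(m::nat) (L :: nat \<Rightarrow> 4 cut).
       (\<forall>i<m. valid_linear_cut (L i)) \<longrightarrow>
       (\<exists>(Q::real^4^4) (c::real^4). submodular_instance Q c \<and>
          0 < relaxation_gap Q c m L \<and>
          ereal (\<delta> / (real m + 1)^2) \<le> relaxation_gap Q c m L))"
proof (rule exI[of _ 1], intro conjI allI impI)
  fix m and L :: "nat \<Rightarrow> 4 cut"
  assume valid: "\<forall>i<m. valid_linear_cut (L i)"
  obtain t where t: "1/2 \<le> t" "t < 1" and unblocked:
    "\<And>i. i < m \<Longrightarrow> (\<exists>z\<in>polygon_points t. L i z (rank_one z) \<noteq> 0)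
      \<or> 0 \<le> cut_slope (L i) (- rank_one escape_direction)"
    using ex_unblocked_polygon valid by metis
  have "\<exists>Q c. submodular_instance Q c \<and> 1 \<le> relaxation_gap Q c m L"
  proof (rule gap_if_no_cut_blocks[where Z = "polygon_points t" and v = escape_direction
        and Q = "polygon_Q t" and c = "polygon_c t"])
    show "submodular_instance (polygon_Q t) (polygon_c t)"
      using t by (intro submodular_polygon_instance)
    show "\<forall>y\<in>unit_box. 0 \<le> y \<bullet> (polygon_Q t *v y) + polygon_c t \<bullet> y"
      using polygon_objective_nonneg[OF t] by blast
    show "finite (polygon_points t)" "polygon_points t \<noteq> {}" by (simp_all add: polygon_points_def)
    show "polygon_points t \<subseteq> unit_box" using t by (intro polygon_points_subset_unit_box) auto
    show "(0, escape_direction) \<in> span (Pair (1::real) ` polygon_points t)"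
      using t by (intro escape_direction_in_span)
    show "0 < escape_direction \<bullet> (polygon_Q t *v escape_direction)"
      unfolding escape_direction_form using t by simp
  qed (use valid unblocked polygon_objective_zero in auto)
  then obtain Q c where "submodular_instance Q c" and gap: "1 \<le> relaxation_gap Q c m L" by blast
  moreover have "0 < relaxation_gap Q c m L" using gap by (rule less_le_trans[rotated]) simp
  moreover have "ereal (1 / (real m + 1)\<^sup>2) \<le> relaxation_gap Q c m L"
  proof (rule order_trans[OF _ gap])
    have "1 \<le> (real m + 1)\<^sup>2" by (rule one_le_power) simp
    then show "ereal (1 / (real m + 1)\<^sup>2) \<le> 1" by (simp add: one_ereal_def)
  qed
  ultimately show "\<exists>Q c. submodular_instance Q c \<and> 0 < relaxation_gap Q c m L
      \<and> ereal (1 / (real m + 1)\<^sup>2) \<le> relaxation_gap Q c m L" by blast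
qed simp

end
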